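(* Let $f:(a,b)\to\mathbb{R}$ be a continuously differentiable uniformly convex function with modulus $\Phi$. Let $x_1,\dots,x_n\in(a,b)$, let $(a_1,\dots,a_n)$ be a nonnegative $n$-tuple with $A_n=\sum_{i=1}^n a_i>0$, let $\overline{x}=\frac{1}{A_n}\sum_{i=1}^n a_ix_i$, and let $\lambda_i\in[0,1]$, $i=1,\dots,n$. Then $$\frac{1}{A_n}\sum_{i=1}^n a_if(x_i)-\frac{1}{A_n}\sum_{i=1}^n a_if\big((1-\lambda_i)\overline{x}+\lambda_ix_i\big)$$ $$\le\frac{1}{A_n}\sum_{i=1}^n a_i(1-\lambda_i)f'(x_i)(x_i-\overline{x})-\frac{1}{A_n}\sum_{i=1}^n a_i\Phi\big((1-\lambda_i)|\overline{x}-x_i|\big).$$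
   Context: A function $f$ on an interval with endpoints $a<b$ is uniformly convex with modulus $\Phi:[0,b-a]\to[0,\infty)$ if $tf(x)+(1-t)f(y)\ge f(tx+(1-t)y)+t(1-t)\Phi(|x-y|)$ for all $x,y$ in the interval and all $t\in[0,1]$. By standing convention the modulus $\Phi$ is increasing with $\Phi(0)=0$. *)

theory Defs
  imports "HOL-Analysis.Analysis"
begin

text \<open>A modulus is a function \<open>[0, d] \<rightarrow> [0, \<infinity>)\<close>; its values outside \<open>[0, d]\<close> are irrelevant.
  \<open>Increasing\<close> is read as nondecreasing, which includes the strictly increasing case.\<close>

definition convexity_modulus :: "real \<Rightarrow> (real \<Rightarrow> real) \<Rightarrow> bool" where
  "convexity_modulus d \<Phi> \<longleftrightarrow>
     (\<forall>r\<in>{0..d}. 0 \<le> \<Phi> r) \<and> mono_on {0..d} \<Phi> \<and> \<Phi> 0 = 0"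

text \<open>To be used for a bounded nondegenerate interval \<open>I\<close> (open, closed or half-open) only;
  its endpoints are \<open>Inf I\<close> and \<open>Sup I\<close>.\<close>

definition uniformly_convex_on :: "real set \<Rightarrow> (real \<Rightarrow> real) \<Rightarrow> (real \<Rightarrow> real) \<Rightarrow> bool" where
  "uniformly_convex_on I \<Phi> f \<longleftrightarrow>
     convexity_modulus (Sup I - Inf I) \<Phi> \<and>
     (\<forall>x\<in>I. \<forall>y\<in>I. \<forall>t\<in>{0..1}.
        t * f x + (1 - t) * f y \<ge> f (t * x + (1 - t) * y) + t * (1 - t) * \<Phi> \<bar>x - y\<bar>)"

lemma uniformly_convex_on_open_interval:
  assumes "a < b"
  shows "uniformly_convex_on {a<..<b} \<Phi> f \<longleftrightarrow>
     convexity_modulus (b - a) \<Phi> \<and>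
     (\<forall>x\<in>{a<..<b}. \<forall>y\<in>{a<..<b}. \<forall>t\<in>{0..1}.
        t * f x + (1 - t) * f y \<ge> f (t * x + (1 - t) * y) + t * (1 - t) * \<Phi> \<bar>x - y\<bar>)"
  using assms by (simp add: uniformly_convex_on_def)

end

theory Submission
  imports Defs
begin

text \<open>A uniformly convex function lies above each tangent line by at least the modulus of the
  distance: f(y) >= f(x) + f'(x)(y - x) + \<Phi>(|x - y|). This is
  \<open>uniformly_convex_on_gradient_bound\<close>, obtained by dividing the convexity inequality
  by t and letting t tend to 0 from the right. Applied at \<open>x i\<close> with y = (1 -
  \<lambda>_i) xbar + \<lambda>_i x_i, a point of the interval by convexity, it bounds each f(x_i) -
  f(y); the weighted average of these bounds is the theorem.\<close>

lemma uniformly_convex_on_gradient_bound: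
  fixes f \<Phi> :: "real \<Rightarrow> real"
  assumes uc: "uniformly_convex_on I \<Phi> f" and x: "x \<in> I" and y: "y \<in> I"
    and deriv: "(f has_real_derivative D) (at x)"
  shows "f x + D * (y - x) + \<Phi> \<bar>x - y\<bar> \<le> f y"
proof -
  let ?q = "\<lambda>t. (f (x + t * (y - x)) - f x) / t"
  have "((\<lambda>t. f (x + t * (y - x))) has_real_derivative D * (y - x)) (at 0)"
    by (rule DERIV_chain2[where f = f and x = 0])
       (use deriv in \<open>auto intro!: derivative_eq_intros\<close>)
  then have "(?q \<longlongrightarrow> D * (y - x)) (at 0)"
    by (simp add: DERIV_def)
  then have lim_q: "(?q \<longlongrightarrow> D * (y - x)) (at_right 0)"
    by (rule tendsto_mono[rotated]) (simp add: at_le)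
  have lim_r: "((\<lambda>t. f y - f x - (1 - t) * \<Phi> \<bar>x - y\<bar>) \<longlongrightarrow>
      f y - f x - (1 - 0) * \<Phi> \<bar>x - y\<bar>) (at_right 0)"
    by (intro tendsto_intros)
  \<comment> \<open>The convexity inequality is used with weight t on \<open>y\<close>, so the
    combination is a small step from \<open>x\<close> towards \<open>y\<close>. Dividing by t > 0
    turns t(1 - t) into 1 - t, which tends to 1, so all of \<Phi> survives in the limit.\<close>
  have le: "\<forall>\<^sub>F t in at_right 0. ?q t \<le> f y - f x - (1 - t) * \<Phi> \<bar>x - y\<bar>"
    unfolding eventually_at_right_field
  proof (intro exI conjI allI impI)
    fix t :: real assume t: "0 < t" "t < 1"
    have "f (t * y + (1 - t) * x) + t * (1 - t) * \<Phi> \<bar>y - x\<bar> \<le> t * f y + (1 - t) * f x"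
      using uc x y t unfolding uniformly_convex_on_def by auto
    moreover have "t * y + (1 - t) * x = x + t * (y - x)"
      by (simp add: algebra_simps)
    ultimately have "f (x + t * (y - x)) - f x \<le> (f y - f x - (1 - t) * \<Phi> \<bar>x - y\<bar>) * t"
      by (simp add: algebra_simps abs_minus_commute)
    then show "?q t \<le> f y - f x - (1 - t) * \<Phi> \<bar>x - y\<bar>"
      using t by (simp add: pos_divide_le_eq)
  qed simp
  have "D * (y - x) \<le> f y - f x - (1 - 0) * \<Phi> \<bar>x - y\<bar>"
    by (rule tendsto_le[OF _ lim_r lim_q le]) simp
  then show ?thesis
    by simp
qed

theorem theorem10:
  fixes a b :: real and f \<Phi> :: "real \<Rightarrow> real"
    and n :: nat and x w lam :: "nat \<Rightarrow> real" and A xbar :: real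
  assumes "a < b"
    and "f C1_differentiable_on {a<..<b}"
    and "uniformly_convex_on {a<..<b} \<Phi> f"
    and "\<And>i. i \<in> {1..n} \<Longrightarrow> x i \<in> {a<..<b}"
    and "\<And>i. i \<in> {1..n} \<Longrightarrow> w i \<ge> 0"
    and "A = (\<Sum>i=1..n. w i)" and "A > 0"
    and "xbar = (1 / A) * (\<Sum>i=1..n. w i * x i)"
    and "\<And>i. i \<in> {1..n} \<Longrightarrow> lam i \<in> {0..1}"
  shows "(1 / A) * (\<Sum>i=1..n. w i * f (x i))
           - (1 / A) * (\<Sum>i=1..n. w i * f ((1 - lam i) * xbar + lam i * x i))
         \<le> (1 / A) * (\<Sum>i=1..n. w i * (1 - lam i) * deriv f (x i) * (x i - xbar))
           - (1 / A) * (\<Sum>i=1..n. w i * \<Phi> ((1 - lam i) * \<bar>xbar - x i\<bar>))"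
proof -
  \<comment> \<open>The weights \<open>w i / A\<close> are nonnegative and sum to 1, so the mean is
    a convex combination of points of the interval.\<close>
  have "(\<Sum>i=1..n. (w i / A) *\<^sub>R x i) \<in> {a<..<b}"
    using assms(4,5,6,7)
    by (intro convex_sum) (auto simp flip: sum_divide_distrib)
  then have xbar: "xbar \<in> {a<..<b}"
    by (simp add: assms(8) sum_distrib_left)
  have term_le: "w i * f (x i) - w i * f ((1 - lam i) * xbar + lam i * x i)
      \<le> w i * (1 - lam i) * deriv f (x i) * (x i - xbar)
        - w i * \<Phi> ((1 - lam i) * \<bar>xbar - x i\<bar>)" if i: "i \<in> {1..n}" for i
  proof -
    let ?y = "(1 - lam i) * xbar + lam i * x i"
    have lam: "0 \<le> lam i" "lam i \<le> 1"
      using assms(9)[OF i] by auto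
    have y: "?y \<in> {a<..<b}"
      using convexD[OF convex_real_interval(8) xbar assms(4)[OF i], of "1 - lam i" "lam i"] lam
      by simp
    have "f differentiable at (x i)"
      using assms(2) assms(4)[OF i] by (auto simp: C1_differentiable_on_eq)
    then have "(f has_real_derivative deriv f (x i)) (at (x i))"
      using DERIV_deriv_iff_real_differentiable by blast
    from uniformly_convex_on_gradient_bound[OF assms(3) assms(4)[OF i] y this]
    have grad: "f (x i) + deriv f (x i) * (?y - x i) + \<Phi> \<bar>x i - ?y\<bar> \<le> f ?y" .
    \<comment> \<open>The step from \<open>x i\<close> to \<open>?y\<close> is the step to
      \<open>xbar\<close> scaled by \<open>1 - lam i\<close>. This gives the factor in the
      derivative term and, as it is nonnegative, the argument of \<Phi>.\<close>
    have diff: "?y - x i = (1 - lam i) * (xbar - x i)"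
      by (simp add: algebra_simps)
    have dist: "\<bar>x i - ?y\<bar> = (1 - lam i) * \<bar>xbar - x i\<bar>"
      using lam by (simp only: abs_minus_commute[of "x i"] diff abs_mult)
    have "deriv f (x i) * ((1 - lam i) * (xbar - x i))
        = - ((1 - lam i) * deriv f (x i) * (x i - xbar))"
      by (simp add: algebra_simps)
    with grad have "f (x i) - f ?y
        \<le> (1 - lam i) * deriv f (x i) * (x i - xbar) - \<Phi> ((1 - lam i) * \<bar>xbar - x i\<bar>)"
      unfolding dist diff by linarith
    from mult_left_mono[OF this assms(5)[OF i]] show ?thesis
      by (simp only: mult.assoc right_diff_distrib[of "w i" "f _"]
        right_diff_distrib[of "w i" "_ * _"])
  qed
  show ?thesis
    \<comment> \<open>The termwise bounds are summed and scaled by the positive factor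
      \<open>1 / A\<close>.\<close>
    using mult_left_mono[OF sum_mono[of "{1..n}", OF term_le], where c = "1 / A"] assms(7)
    by (simp only: sum_subtractf right_diff_distrib[of "1 / A"]) simp
qed

end
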